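(* Let $n \ge 1$ be an integer and let $p_1, \dots, p_n$ be univariate real polynomials of degree at most $n$ with $\|p_i\|_\infty \le 1$ for all $i \in \{1,\dots,n\}$. Then there exist signs $x_1, \dots, x_n \in \{-1,1\}$ such that \[\Big\|\sum_{i=1}^n x_i p_i\Big\|_\infty < 30\sqrt{n}.\]
   Context: For a univariate real polynomial $p : \mathbb{R} \to \mathbb{R}$, the Chebyshev norm is $\|p\|_\infty := \sup_{|x| \le 1} |p(x)|$, the supremum being over real $x \in [-1,1]$. *)

theory Defs
  imports "HOL-Analysis.Analysis" "HOL-Computational_Algebra.Polynomial"
begin

definition chebyshev_norm :: "real poly \<Rightarrow> real" where
  "chebyshev_norm p = (SUP x\<in>{-1..1}. \<bar>poly p x\<bar>)"

text \<open>The supremum on type \<^typ>\<open>real\<close> is only meaningful for nonempty sets that are bounded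
  above; the following shows that this is always the case here.\<close>

lemma bdd_above_abs_poly: "bdd_above ((\<lambda>x. \<bar>poly p x\<bar>) ` {-1..1::real})"
  by (intro compact_imp_bounded bounded_imp_bdd_above compact_continuous_image
        continuous_intros compact_Icc)

end

theory Submission
  imports Defs
begin

text \<open>For degree at most \<open>n\<close>, the Chebyshev norm is at most \<open>\<surd>2\<close> times the maximum of the absolute values
  at the \<open>2 n\<close> Chebyshev nodes (discrete Parseval at \<open>4 n\<close> points of the unit circle, against a
  Dirichlet kernel of length \<open>2 n\<close>). It remains to balance \<open>4 n\<close> one-sided linear constraints with
  coefficients of modulus at most 1, as in Spencer's theorem. Assign to a point \<open>x\<close> of the cube the
  potential \<open>\<Sum> 1 / gap\<^sup>2\<close>, where the gaps are the slacks to a barrier that rises with \<open>\<parallel>x\<parallel>\<close>, and take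
  \<open>x\<close> of maximal norm among the points of potential at most \<open>1 / 9\<close>. While at least three coordinates
  are fractional, a trace argument gives a direction orthogonal to \<open>x\<close> and to all nearly tight
  constraints along which the rise of the barrier pays for the second-order growth of the potential,
  contradicting maximality. Hence at most two coordinates are fractional, and rounding them costs
  at most 2. This gives the bound \<open>14 \<surd>n\<close> at the nodes, and \<open>14 \<surd>2 < 30\<close>.\<close>

subsection \<open>Orthonormal families in kernels\<close>

text \<open>Gaussian elimination, by induction on the set of equations. An equation that is zero on
  \<open>A\<close> is dropped; otherwise a pivot variable \<open>k\<close> is eliminated from the
  others (\<open>c'\<close>), so one equation and one variable disappear together, and
  \<open>v\<close> recovers the value at \<open>k\<close> by back substitution.\<close>

lemma homogeneous_system_nontrivial_solution:
  fixes c :: "'r \<Rightarrow> 'a \<Rightarrow> real"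
  assumes "finite R" "finite A" "card R < card A"
  shows "\<exists>u. (\<forall>i. i \<notin> A \<longrightarrow> u i = 0) \<and> (\<exists>i\<in>A. u i \<noteq> 0) \<and> (\<forall>r\<in>R. (\<Sum>i\<in>A. c r i * u i) = 0)"
  using assms
proof (induction R arbitrary: A c rule: finite_induct)
  case empty
  then obtain i where "i \<in> A" by (metis card_gt_0_iff ex_in_conv card.empty)
  then show ?case
    by (intro exI[of _ "\<lambda>j. if j = i then 1 else 0"]) auto
next
  case (insert r R)
  show ?case
  proof (cases "\<forall>i\<in>A. c r i = 0")
    case True
    have "card R < card A" using insert by simp
    from insert.IH[OF insert.prems(1) this, of c] show ?thesis using True by auto
  next
    case False
    then obtain k where k: "k \<in> A" "c r k \<noteq> 0" by auto
    define B where "B = A - {k}"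
    have B: "finite B" "card R < card B" "k \<notin> B" "A = insert k B"
      using insert k by (auto simp: B_def)
    define c' where "c' = (\<lambda>s i. c s i - c s k * c r i / c r k)"
    from insert.IH[OF B(1,2), of c'] obtain u where u: "\<forall>i. i \<notin> B \<longrightarrow> u i = 0" "\<exists>i\<in>B. u i \<noteq> 0"
      "\<forall>s\<in>R. (\<Sum>i\<in>B. c' s i * u i) = 0" by blast
    define v where "v = u(k := - (\<Sum>i\<in>B. c r i * u i) / c r k)"
    have v: "(\<Sum>i\<in>A. c s i * v i) = c s k * v k + (\<Sum>i\<in>B. c s i * u i)" for s
      using B by (auto simp: v_def intro!: sum.cong)
    have "(\<Sum>i\<in>A. c r i * v i) = 0"
      unfolding v using k by (simp add: v_def)
    moreover have "(\<Sum>i\<in>A. c s i * v i) = 0" if "s \<in> R" for s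
    proof -
      have "0 = (\<Sum>i\<in>B. c s i * u i - c s k / c r k * (c r i * u i))"
        using u(3) that by (auto simp: c'_def algebra_simps)
      also have "\<dots> = (\<Sum>i\<in>B. c s i * u i) - c s k / c r k * (\<Sum>i\<in>B. c r i * u i)"
        by (simp add: sum_subtractf sum_distrib_left)
      finally show ?thesis unfolding v by (simp add: v_def)
    qed
    moreover have "\<exists>i\<in>A. v i \<noteq> 0"
      using u(2) B by (auto simp: v_def)
    ultimately show ?thesis using u(1) B(4) by (intro exI[of _ v]) (auto simp: v_def)
  qed
qed

text \<open>The vectors are found one at a time: the next one is a normalised nontrivial solution of
  the system enlarged by the conditions of orthogonality to the earlier ones. The disjoint sum
  \<open>R <+> {..<l}\<close> indexes this larger system.\<close>

lemma orthonormal_family_in_kernel: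
  fixes c :: "'r \<Rightarrow> 'a \<Rightarrow> real"
  assumes "finite R" "finite A" "card R + l \<le> card A"
  shows "\<exists>e :: nat \<Rightarrow> 'a \<Rightarrow> real. (\<forall>s<l. \<forall>i. i \<notin> A \<longrightarrow> e s i = 0) \<and>
    (\<forall>s<l. \<forall>t<l. (\<Sum>i\<in>A. e s i * e t i) = (if s = t then 1 else 0)) \<and>
    (\<forall>s<l. \<forall>r\<in>R. (\<Sum>i\<in>A. c r i * e s i) = 0)"
  using assms(3)
proof (induction l)
  case 0
  then show ?case by auto
next
  case (Suc l)
  then have "card R + l \<le> card A" by simp
  from Suc.IH[OF this] obtain e :: "nat \<Rightarrow> 'a \<Rightarrow> real" where e: "\<And>s i. s < l \<Longrightarrow> i \<notin> A \<Longrightarrow> e s i = 0"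
    "\<And>s t. s < l \<Longrightarrow> t < l \<Longrightarrow> (\<Sum>i\<in>A. e s i * e t i) = (if s = t then 1 else 0)"
    "\<And>s r. s < l \<Longrightarrow> r \<in> R \<Longrightarrow> (\<Sum>i\<in>A. c r i * e s i) = 0" by blast
  have "card (R <+> {..<l}) < card A" using Suc.prems assms(1) by (simp add: card_Plus)
  from homogeneous_system_nontrivial_solution[OF _ assms(2) this, of "case_sum c e"] assms(1)
  obtain u where u: "\<And>i. i \<notin> A \<Longrightarrow> u i = 0" "\<exists>i\<in>A. u i \<noteq> 0"
    "\<forall>r\<in>R <+> {..<l}. (\<Sum>i\<in>A. case_sum c e r i * u i) = 0" by auto
  have uR: "(\<Sum>i\<in>A. c r i * u i) = 0" if "r \<in> R" for r using u(3) that by (auto dest!: bspec[of _ _ "Inl r"])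
  have ue: "(\<Sum>i\<in>A. e s i * u i) = 0" if "s < l" for s using u(3) that by (auto dest!: bspec[of _ _ "Inr s"])
  define q where "q = (\<Sum>i\<in>A. (u i)\<^sup>2)"
  have q: "q > 0" unfolding q_def using u(2) assms(2) by (auto intro!: sum_pos2)
  define v where "v = (\<lambda>i. u i / sqrt q)"
  have vv: "(\<Sum>i\<in>A. v i * v i) = 1"
  proof -
    have "(\<Sum>i\<in>A. v i * v i) = (\<Sum>i\<in>A. (u i)\<^sup>2 / q)"
      using q by (intro sum.cong) (auto simp: v_def power2_eq_square)
    also have "\<dots> = 1" using q by (simp add: sum_divide_distrib[symmetric] q_def[symmetric])
    finally show ?thesis .
  qed
  have ev: "(\<Sum>i\<in>A. e s i * v i) = 0" "(\<Sum>i\<in>A. v i * e s i) = 0" if "s < l" for s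
    using ue[OF that] by (simp_all add: v_def sum_divide_distrib[symmetric] mult.commute)
  have Rv: "(\<Sum>i\<in>A. c r i * v i) = 0" if "r \<in> R" for r
    using uR[OF that] by (simp add: v_def sum_divide_distrib[symmetric])
  define e' where "e' = (\<lambda>s. if s = l then v else e s)"
  show ?case
  proof (intro exI[of _ e'] conjI allI impI ballI)
    fix s i assume "s < Suc l" "i \<notin> A"
    then show "e' s i = 0" using e(1)[of s i] u(1)[of i] by (auto simp: e'_def v_def less_Suc_eq)
  next
    fix s t assume "s < Suc l" "t < Suc l"
    then show "(\<Sum>i\<in>A. e' s i * e' t i) = (if s = t then 1 else 0)"
      using e(2)[of s t] ev vv by (auto simp: e'_def less_Suc_eq)
  next
    fix s r assume "s < Suc l" "r \<in> R"
    then show "(\<Sum>i\<in>A. c r i * e' s i) = 0"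
      using e(3)[of s r] Rv by (auto simp: e'_def less_Suc_eq)
  qed
qed

text \<open>Expansion of the squared norm of \<open>a\<close> minus its projection onto the span of
  the \<open>e s\<close>, which is nonnegative.\<close>

lemma bessel_finite:
  fixes e :: "nat \<Rightarrow> 'a \<Rightarrow> real"
  assumes "finite A"
    and "\<And>s t. s < l \<Longrightarrow> t < l \<Longrightarrow> (\<Sum>i\<in>A. e s i * e t i) = (if s = t then 1 else 0)"
  shows "(\<Sum>s<l. (\<Sum>i\<in>A. a i * e s i)\<^sup>2) \<le> (\<Sum>i\<in>A. (a i)\<^sup>2)"
proof -
  define g where "g = (\<lambda>s. \<Sum>i\<in>A. a i * e s i)"
  have "0 \<le> (\<Sum>i\<in>A. (a i - (\<Sum>s<l. g s * e s i))\<^sup>2)" by (intro sum_nonneg) auto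
  also have "\<dots> = (\<Sum>i\<in>A. (a i)\<^sup>2) - 2 * (\<Sum>i\<in>A. a i * (\<Sum>s<l. g s * e s i)) + (\<Sum>i\<in>A. (\<Sum>s<l. g s * e s i)\<^sup>2)"
    by (simp add: power2_diff sum.distrib sum_subtractf sum_distrib_left mult.assoc)
  also have "(\<Sum>i\<in>A. a i * (\<Sum>s<l. g s * e s i)) = (\<Sum>s<l. g s * (\<Sum>i\<in>A. a i * e s i))"
    unfolding sum_distrib_left by (subst sum.swap) (simp add: mult_ac)
  also have "\<dots> = (\<Sum>s<l. (g s)\<^sup>2)" by (simp add: g_def power2_eq_square)
  also have "(\<Sum>i\<in>A. (\<Sum>s<l. g s * e s i)\<^sup>2) = (\<Sum>i\<in>A. \<Sum>s<l. \<Sum>t<l. g s * g t * (e s i * e t i))"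
    by (simp add: power2_eq_square sum_product mult_ac)
  also have "\<dots> = (\<Sum>s<l. \<Sum>t<l. \<Sum>i\<in>A. g s * g t * (e s i * e t i))"
    by (subst sum.swap, rule sum.cong[OF refl], subst sum.swap) simp
  also have "\<dots> = (\<Sum>s<l. \<Sum>t<l. g s * g t * (if s = t then 1 else 0))"
    by (intro sum.cong refl) (simp add: sum_distrib_left[symmetric] assms(2))
  also have "\<dots> = (\<Sum>s<l. (g s)\<^sup>2)" by (simp add: power2_eq_square sum.delta' if_distrib cong: if_cong)
  finally show ?thesis by (simp add: g_def)
qed

text \<open>Averaging over an orthonormal family of \<open>card A - card R\<close> vectors in the
  kernel: by Bessel the quadratic form sums over the family to at most its trace, so some member
  takes at most the average share.\<close>

lemma low_energy_direction:
  fixes c :: "'r \<Rightarrow> 'a \<Rightarrow> real" and a :: "'b \<Rightarrow> 'a \<Rightarrow> real"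
  assumes "finite R" "finite A" "card R < card A" "\<And>j. j \<in> J \<Longrightarrow> w j \<ge> 0"
  obtains u where "\<And>i. i \<notin> A \<Longrightarrow> u i = 0" "(\<Sum>i\<in>A. (u i)\<^sup>2) = 1"
    "\<And>r. r \<in> R \<Longrightarrow> (\<Sum>i\<in>A. c r i * u i) = 0"
    "real (card A - card R) * (\<Sum>j\<in>J. w j * (\<Sum>i\<in>A. a j i * u i)\<^sup>2) \<le> (\<Sum>j\<in>J. w j * (\<Sum>i\<in>A. (a j i)\<^sup>2))"
proof -
  define l where "l = card A - card R"
  have "card R + l \<le> card A" "l > 0" using assms(3) by (auto simp: l_def)
  from orthonormal_family_in_kernel[OF assms(1,2) this(1), of c]
  obtain e :: "nat \<Rightarrow> 'a \<Rightarrow> real" where e: "\<And>s i. s < l \<Longrightarrow> i \<notin> A \<Longrightarrow> e s i = 0"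
    "\<And>s t. s < l \<Longrightarrow> t < l \<Longrightarrow> (\<Sum>i\<in>A. e s i * e t i) = (if s = t then 1 else 0)"
    "\<And>s r. s < l \<Longrightarrow> r \<in> R \<Longrightarrow> (\<Sum>i\<in>A. c r i * e s i) = 0" by blast
  define Q where "Q = (\<lambda>s. \<Sum>j\<in>J. w j * (\<Sum>i\<in>A. a j i * e s i)\<^sup>2)"
  define T where "T = (\<Sum>j\<in>J. w j * (\<Sum>i\<in>A. (a j i)\<^sup>2))"
  have QT: "(\<Sum>s<l. Q s) \<le> T"
  proof -
    have "(\<Sum>s<l. Q s) = (\<Sum>j\<in>J. w j * (\<Sum>s<l. (\<Sum>i\<in>A. a j i * e s i)\<^sup>2))"
      unfolding Q_def sum_distrib_left by (rule sum.swap)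
    also have "\<dots> \<le> T" unfolding T_def
      by (intro sum_mono mult_left_mono bessel_finite assms e(2)) auto
    finally show ?thesis .
  qed
  have "\<exists>s<l. real l * Q s \<le> T"
  proof (rule ccontr)
    assume "\<not> ?thesis"
    then have "(\<Sum>s<l. T) < (\<Sum>s<l. real l * Q s)"
      using \<open>l > 0\<close> by (intro sum_strict_mono) auto
    also have "\<dots> \<le> real l * T" using QT by (simp add: sum_distrib_left[symmetric] mult_left_mono)
    finally show False by simp
  qed
  then obtain s where s: "s < l" "real l * Q s \<le> T" by blast
  show ?thesis
    by (rule that[of "e s"]) (use s e(1,3) e(2)[of s s] in \<open>auto simp: Q_def T_def l_def power2_eq_square\<close>)
qed

subsection \<open>The barrier potential\<close>

text \<open>With \<open>x = h / d\<close> and after multiplication by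
  \<open>(1 + x)\<^sup>2\<close>, the two sides differ by
  \<open>x\<^sup>2 * (1 + 6 * x + 4 * x\<^sup>2)\<close>, which is nonnegative for
  \<open>x \<ge> - 1/6\<close>. The coefficient 4, instead of the Taylor coefficient 3, absorbs the
  remainder.\<close>

lemma inverse_square_perturb:
  fixes d h :: real
  assumes "d > 0" "h \<ge> - d / 6"
  shows "1 / (d + h)\<^sup>2 \<le> 1 / d\<^sup>2 - 2 * h / d ^ 3 + 4 * h\<^sup>2 / d ^ 4"
proof -
  define x where "x = h / d"
  have h: "h = d * x" and x: "x \<ge> - 1/6" using assms by (auto simp: x_def field_simps)
  have "0 \<le> x\<^sup>2 * (1 + 6 * x + 4 * x\<^sup>2)" using x by (intro mult_nonneg_nonneg) auto
  then have "1 \<le> (1 - 2 * x + 4 * x\<^sup>2) * (1 + x)\<^sup>2"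
    by (simp add: power2_eq_square algebra_simps)
  then have "1 / (1 + x)\<^sup>2 \<le> 1 - 2 * x + 4 * x\<^sup>2" using x by (simp add: divide_le_eq)
  then have "1 / (1 + x)\<^sup>2 / d\<^sup>2 \<le> (1 - 2 * x + 4 * x\<^sup>2) / d\<^sup>2" by (rule divide_right_mono) simp
  moreover have "(d + h)\<^sup>2 = (1 + x)\<^sup>2 * d\<^sup>2" by (simp add: h power2_eq_square algebra_simps)
  moreover have "(1 - 2 * x + 4 * x\<^sup>2) / d\<^sup>2 = 1 / d\<^sup>2 - 2 * h / d ^ 3 + 4 * h\<^sup>2 / d ^ 4"
    using assms(1) by (simp add: h field_simps power2_eq_square power3_eq_cube power4_eq_xxxx)
  ultimately show ?thesis by simp
qed

text \<open>The average over \<open>\<sigma> = -1, 1\<close> cancels the term linear in \<open>\<epsilon>\<close>, so one sign does no worse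
  than the quadratic term.\<close>

lemma potential_step:
  fixes d g :: "'b \<Rightarrow> real"
  assumes "finite J" and d: "\<And>j. j \<in> J \<Longrightarrow> d j > 0" and "\<beta> > 0"
    and lt: "2 * (\<Sum>j\<in>J. (g j)\<^sup>2 / d j ^ 4) < \<beta> * (\<Sum>j\<in>J. 1 / d j ^ 3)"
  shows "\<forall>\<^sub>F \<epsilon> in at_right 0. (\<forall>j\<in>J. d j + \<beta> * \<epsilon>\<^sup>2 - \<epsilon> * \<bar>g j\<bar> > 0) \<and>
    (\<exists>\<sigma>\<in>{-1, 1}. (\<Sum>j\<in>J. 1 / (d j + \<beta> * \<epsilon>\<^sup>2 - \<sigma> * \<epsilon> * g j)\<^sup>2) \<le> (\<Sum>j\<in>J. 1 / (d j)\<^sup>2))"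
proof -
  \<comment> \<open>The threshold \<open>d j / 6\<close> is the range in which
    \<open>inverse_square_perturb\<close> applies, for either sign.\<close>
  have t1: "\<forall>\<^sub>F \<epsilon> in at_right 0. \<forall>j\<in>J. \<epsilon> * \<bar>g j\<bar> < d j / 6"
  proof (intro eventually_ball_finite \<open>finite J\<close> ballI)
    fix j assume "j \<in> J"
    have "((\<lambda>\<epsilon>. \<epsilon> * \<bar>g j\<bar>) \<longlongrightarrow> 0 * \<bar>g j\<bar>) (at_right 0)" by (intro tendsto_intros)
    then show "\<forall>\<^sub>F \<epsilon> in at_right 0. \<epsilon> * \<bar>g j\<bar> < d j / 6"
      using d[OF \<open>j \<in> J\<close>] by (intro order_tendstoD(2)) auto
  qed
  define S3 S4 V where "S3 = (\<Sum>j\<in>J. 1 / d j ^ 3)" and "S4 = (\<Sum>j\<in>J. 1 / d j ^ 4)"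
    and "V = (\<Sum>j\<in>J. (g j)\<^sup>2 / d j ^ 4)"
  have "((\<lambda>\<epsilon>. 2 * V + 2 * \<beta>\<^sup>2 * S4 * \<epsilon>\<^sup>2) \<longlongrightarrow> 2 * V + 2 * \<beta>\<^sup>2 * S4 * 0\<^sup>2) (at_right 0)"
    by (intro tendsto_intros)
  \<comment> \<open>Up to the factor 4 this says that the bracket multiplying
    \<open>\<epsilon>\<^sup>2\<close> below is negative after summation: \<open>lt\<close> makes its
    limit negative, and the term with \<open>S4\<close> vanishes as \<open>\<epsilon>\<close> tends
    to 0.\<close>
  then have t2: "\<forall>\<^sub>F \<epsilon> in at_right 0. 2 * V + 2 * \<beta>\<^sup>2 * S4 * \<epsilon>\<^sup>2 < \<beta> * S3"
    using lt by (intro order_tendstoD(2)) (auto simp: V_def S3_def)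
  have t3: "\<forall>\<^sub>F \<epsilon> in at_right 0. \<epsilon> > (0::real)" by (simp add: eventually_at_right_less)
  show ?thesis using t1 t2 t3
  proof eventually_elim
    case (elim \<epsilon>)
    have pos: "\<beta> * \<epsilon>\<^sup>2 > 0" using elim assms by simp
    define f where "f = (\<lambda>\<sigma>. \<Sum>j\<in>J. 1 / (d j + \<beta> * \<epsilon>\<^sup>2 - \<sigma> * \<epsilon> * g j)\<^sup>2)"
    have bnd: "1 / (d j + \<beta> * \<epsilon>\<^sup>2 - \<epsilon> * g j)\<^sup>2 + 1 / (d j + \<beta> * \<epsilon>\<^sup>2 + \<epsilon> * g j)\<^sup>2
       \<le> 2 * (1 / (d j)\<^sup>2) + \<epsilon>\<^sup>2 * (8 * ((g j)\<^sup>2 / d j ^ 4) - 4 * \<beta> * (1 / d j ^ 3) + 8 * \<beta>\<^sup>2 * \<epsilon>\<^sup>2 * (1 / d j ^ 4))"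
      (is "?L \<le> ?R") if j: "j \<in> J" for j
    proof -
      have dj: "d j > 0" using d j by auto
      have a: "\<bar>\<epsilon> * g j\<bar> < d j / 6" using elim j by (auto simp: abs_mult)
      have "1 / (d j + (\<beta> * \<epsilon>\<^sup>2 - \<epsilon> * g j))\<^sup>2 \<le> 1 / (d j)\<^sup>2 - 2 * (\<beta> * \<epsilon>\<^sup>2 - \<epsilon> * g j) / d j ^ 3 + 4 * (\<beta> * \<epsilon>\<^sup>2 - \<epsilon> * g j)\<^sup>2 / d j ^ 4"
        using a pos by (intro inverse_square_perturb dj) linarith
      moreover have "1 / (d j + (\<beta> * \<epsilon>\<^sup>2 + \<epsilon> * g j))\<^sup>2 \<le> 1 / (d j)\<^sup>2 - 2 * (\<beta> * \<epsilon>\<^sup>2 + \<epsilon> * g j) / d j ^ 3 + 4 * (\<beta> * \<epsilon>\<^sup>2 + \<epsilon> * g j)\<^sup>2 / d j ^ 4"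
        using a pos by (intro inverse_square_perturb dj) linarith
      ultimately have "?L \<le> 1 / (d j)\<^sup>2 - 2 * (\<beta> * \<epsilon>\<^sup>2 - \<epsilon> * g j) / d j ^ 3 + 4 * (\<beta> * \<epsilon>\<^sup>2 - \<epsilon> * g j)\<^sup>2 / d j ^ 4 +
         (1 / (d j)\<^sup>2 - 2 * (\<beta> * \<epsilon>\<^sup>2 + \<epsilon> * g j) / d j ^ 3 + 4 * (\<beta> * \<epsilon>\<^sup>2 + \<epsilon> * g j)\<^sup>2 / d j ^ 4)"
        by (simp add: add_diff_eq add.assoc)
      also have "\<dots> = ?R" using dj by (simp add: field_simps power2_eq_square) 
      finally show ?thesis .
    qed
    have "f 1 + f (-1) \<le> (\<Sum>j\<in>J. 2 * (1 / (d j)\<^sup>2) + \<epsilon>\<^sup>2 * (8 * ((g j)\<^sup>2 / d j ^ 4) - 4 * \<beta> * (1 / d j ^ 3) + 8 * \<beta>\<^sup>2 * \<epsilon>\<^sup>2 * (1 / d j ^ 4)))"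
      unfolding f_def sum.distrib[symmetric] by (intro sum_mono) (use bnd in auto)
    also have "\<dots> = 2 * (\<Sum>j\<in>J. 1 / (d j)\<^sup>2) + \<epsilon>\<^sup>2 * (8 * V - 4 * \<beta> * S3 + 8 * \<beta>\<^sup>2 * \<epsilon>\<^sup>2 * S4)"
      by (simp only: sum.distrib sum_distrib_left[symmetric] sum_subtractf V_def S3_def S4_def)
    also have "\<dots> \<le> 2 * (\<Sum>j\<in>J. 1 / (d j)\<^sup>2)"
    proof -
      have "8 * V - 4 * \<beta> * S3 + 8 * \<beta>\<^sup>2 * \<epsilon>\<^sup>2 * S4 \<le> 0" using elim by (simp add: algebra_simps)
      then show ?thesis by (simp add: mult_nonneg_nonpos)
    qed
    finally have "f 1 \<le> (\<Sum>j\<in>J. 1 / (d j)\<^sup>2) \<or> f (-1) \<le> (\<Sum>j\<in>J. 1 / (d j)\<^sup>2)" by linarith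
    moreover have "d j + \<beta> * \<epsilon>\<^sup>2 - \<epsilon> * \<bar>g j\<bar> > 0" if "j \<in> J" for j
    proof -
      have "\<epsilon> * \<bar>g j\<bar> < d j / 6" "d j > 0" using elim(1) d that by auto
      then show ?thesis using pos by linarith
    qed
    ultimately show ?case by (auto simp: f_def)
  qed
qed

section \<open>Compactness and improvement of feasible points\<close>

text \<open>The index type may be infinite, so this is Tychonoff's theorem in the product topology,
  with the coordinates outside \<open>I\<close> confined to the compact set
  \<open>{0}\<close>.\<close>

lemma compact_real_cube:
  fixes I :: "'a set"
  shows "compact {x :: 'a \<Rightarrow> real. (\<forall>i\<in>I. \<bar>x i\<bar> \<le> 1) \<and> (\<forall>i. i \<notin> I \<longrightarrow> x i = 0)}"
proof -
  have "compactin (product_topology (\<lambda>i. euclidean) UNIV) (PiE UNIV (\<lambda>i. if i \<in> I then {-1..1::real} else {0}))"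
    unfolding compactin_PiE by auto
  moreover have "PiE UNIV (\<lambda>i. if i \<in> I then {-1..1::real} else {0}) = {x. (\<forall>i\<in>I. \<bar>x i\<bar> \<le> 1) \<and> (\<forall>i. i \<notin> I \<longrightarrow> x i = 0)}"
  proof (intro set_eqI)
    fix x :: "'a \<Rightarrow> real"
    have "x \<in> PiE UNIV (\<lambda>i. if i \<in> I then {-1..1} else {0}) \<longleftrightarrow> (\<forall>i. (i \<in> I \<longrightarrow> \<bar>x i\<bar> \<le> 1) \<and> (i \<notin> I \<longrightarrow> x i = 0))"
      unfolding PiE_UNIV_domain Pi_iff ball_UNIV by (rule iff_allI) (auto simp: abs_le_iff)
    then show "x \<in> PiE UNIV (\<lambda>i. if i \<in> I then {-1..1} else {0}) \<longleftrightarrow> x \<in> {x. (\<forall>i\<in>I. \<bar>x i\<bar> \<le> 1) \<and> (\<forall>i. i \<notin> I \<longrightarrow> x i = 0)}"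
      by blast
  qed
  ultimately show ?thesis
    by (simp add: euclidean_product_topology)
qed

text \<open>By concavity the graph of the square root lies below its tangent at \<open>s\<close>.
  This turns a gain in squared norm into a linear rise of the barrier.\<close>

lemma sqrt_diff_le:
  fixes s :: real
  assumes "0 < s" "0 \<le> e" "e \<le> s"
  shows "sqrt (s - e) \<le> sqrt s - e / (2 * sqrt s)"
proof (rule real_le_lsqrt)
  have s: "sqrt s * sqrt s = s" using assms by simp
  have "sqrt s * (2 * sqrt s) = 2 * s" using s by simp
  then have "e \<le> sqrt s * (2 * sqrt s)" using assms by linarith
  then have "e / (2 * sqrt s) \<le> sqrt s" using assms by (simp add: divide_le_eq)
  then show "0 \<le> sqrt s - e / (2 * sqrt s)" by simp
  have "(sqrt s - e / (2 * sqrt s))\<^sup>2 = s - e + (e / (2 * sqrt s))\<^sup>2"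
    using assms s by (simp add: power2_diff)
  then show "s - e \<le> (sqrt s - e / (2 * sqrt s))\<^sup>2" by simp
qed

lemma sum_inverse_square_antimono:
  fixes d d' :: "'b \<Rightarrow> real"
  assumes "\<And>j. j \<in> J \<Longrightarrow> 0 < d j" "\<And>j. j \<in> J \<Longrightarrow> d j \<le> d' j"
  shows "(\<Sum>j\<in>J. 1 / (d' j)\<^sup>2) \<le> (\<Sum>j\<in>J. 1 / (d j)\<^sup>2)"
proof (intro sum_mono divide_left_mono power_mono)
  fix j assume j: "j \<in> J"
  have "0 < d j" "0 < d' j" using assms[OF j] by auto
  then show "0 \<le> d j" "0 < (d' j)\<^sup>2 * (d j)\<^sup>2" by simp_all
qed (use assms in auto)

text \<open>The barrier \<open>12 \<surd>n - 6 \<surd>s\<close>, with \<open>s = n - \<parallel>x\<parallel>\<^sup>2\<close>, rises from \<open>6 \<surd>n\<close> to \<open>12 \<surd>n\<close> as \<open>x\<close> moves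
  from the origin to a vertex of the cube. Its rate \<open>3 / \<surd>s\<close> in \<open>\<parallel>x\<parallel>\<^sup>2\<close> is what keeps the potential from
  growing, and \<open>1 / 9\<close> is the potential of \<open>4 n\<close> constraints at the origin.\<close>

definition barrier_gap :: "'a set \<Rightarrow> ('b \<Rightarrow> 'a \<Rightarrow> real) \<Rightarrow> ('a \<Rightarrow> real) \<Rightarrow> 'b \<Rightarrow> real" where
  "barrier_gap I a x j = 12 * sqrt (real (card I)) - 6 * sqrt (real (card I) - (\<Sum>i\<in>I. (x i)\<^sup>2)) - (\<Sum>i\<in>I. a j i * x i)"

text \<open>Positivity of the gaps is a separate condition because the squares in the potential hide
  the sign and \<open>1 / 0 = 0\<close>. Fixing the coordinates outside \<open>I\<close> makes the
  set compact.\<close>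

definition feasible :: "'a set \<Rightarrow> 'b set \<Rightarrow> ('b \<Rightarrow> 'a \<Rightarrow> real) \<Rightarrow> ('a \<Rightarrow> real) set" where
  "feasible I J a = {x. (\<forall>i\<in>I. \<bar>x i\<bar> \<le> 1) \<and> (\<forall>i. i \<notin> I \<longrightarrow> x i = 0) \<and>
     (\<forall>j\<in>J. barrier_gap I a x j > 0) \<and> (\<Sum>j\<in>J. 1 / (barrier_gap I a x j)\<^sup>2) \<le> 1 / 9}"

text \<open>A single term of the potential is at most 1/9. This uniform distance from 0 allows the
  strict gap condition to be replaced by a closed one.\<close>

lemma feasible_gap_ge_3:
  assumes "finite J" "j \<in> J" "x \<in> feasible I J a"
  shows "barrier_gap I a x j \<ge> 3"
proof -
  have p: "barrier_gap I a x j > 0" using assms by (auto simp: feasible_def)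
  have "1 / (barrier_gap I a x j)\<^sup>2 \<le> (\<Sum>j\<in>J. 1 / (barrier_gap I a x j)\<^sup>2)"
    using assms by (intro member_le_sum) auto
  also have "\<dots> \<le> 1 / 9" using assms by (auto simp: feasible_def)
  finally have "3\<^sup>2 \<le> (barrier_gap I a x j)\<^sup>2" using p by (simp add: field_simps)
  then show ?thesis by (rule power2_le_imp_le) (use p in simp)
qed

lemma compact_feasible:
  fixes I :: "'a set" and J :: "'b set"
  assumes "finite I" "finite J"
  shows "compact (feasible I J a)"
proof -
  \<comment> \<open>Truncating the gaps at 3 gives a function that is continuous on the whole space
    and agrees with the potential wherever all gaps are at least 3.\<close>
  define P where "P = (\<lambda>x. \<Sum>j\<in>J. 1 / (max 3 (barrier_gap I a x j))\<^sup>2)"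
  have cg: "continuous_on UNIV (\<lambda>x. barrier_gap I a x j)" for j
    unfolding barrier_gap_def by (intro continuous_intros continuous_on_product_coordinates)
  have cP: "continuous_on UNIV P"
    unfolding P_def
  proof (intro continuous_intros cg ballI)
    fix x j
    have "max 3 (barrier_gap I a x j) > 0" by (simp add: less_max_iff_disj)
    then show "(max 3 (barrier_gap I a x j))\<^sup>2 \<noteq> 0" by simp
  qed
  have "feasible I J a = {x. (\<forall>i\<in>I. \<bar>x i\<bar> \<le> 1) \<and> (\<forall>i. i \<notin> I \<longrightarrow> x i = 0)} \<inter>
      ((\<Inter>j\<in>J. {x. 3 \<le> barrier_gap I a x j}) \<inter> {x. P x \<le> 1 / 9})" (is "_ = ?C \<inter> ?D")
  proof (intro set_eqI iffI)
    fix x assume x: "x \<in> feasible I J a"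
    note g = feasible_gap_ge_3[OF assms(2) _ x]
    have "P x = (\<Sum>j\<in>J. 1 / (barrier_gap I a x j)\<^sup>2)"
      unfolding P_def by (intro sum.cong refl) (use g in \<open>simp add: max_absorb2\<close>)
    then show "x \<in> ?C \<inter> ?D" using x g by (auto simp: feasible_def)
  next
    fix x assume x: "x \<in> ?C \<inter> ?D"
    have "P x = (\<Sum>j\<in>J. 1 / (barrier_gap I a x j)\<^sup>2)"
      unfolding P_def by (intro sum.cong refl) (use x in \<open>auto simp add: max_absorb2\<close>)
    moreover have "barrier_gap I a x j > 0" if "j \<in> J" for j
    proof -
      have "3 \<le> barrier_gap I a x j" using x that by auto
      then show ?thesis by linarith
    qed
    ultimately show "x \<in> feasible I J a" using x by (auto simp: feasible_def)
  qed
  moreover have "closed ?D"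
    by (intro closed_Int closed_INT ballI closed_Collect_le continuous_on_const cg cP)
  ultimately show ?thesis using compact_real_cube[of I] by (simp add: compact_Int_closed)
qed

text \<open>Constraints with gap below \<open>3 \<surd>k / 2\<close>, where \<open>k = card A\<close>, number at most \<open>k / 4\<close> by
  Markov's inequality. Moving orthogonally to them and to \<open>x\<close> still leaves \<open>k / 2\<close> dimensions.\<close>

lemma fractional_direction:
  fixes x :: "'a \<Rightarrow> real" and a :: "'b \<Rightarrow> 'a \<Rightarrow> real" and d :: "'b \<Rightarrow> real"
  assumes fin: "finite A" "finite J" and k: "card A \<ge> 3"
    and a: "\<And>i j. i \<in> A \<Longrightarrow> j \<in> J \<Longrightarrow> \<bar>a j i\<bar> \<le> 1"
    and d: "\<And>j. j \<in> J \<Longrightarrow> d j > 0" and Phi: "(\<Sum>j\<in>J. 1 / (d j)\<^sup>2) \<le> 1 / 9"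
  obtains u where "\<And>i. i \<notin> A \<Longrightarrow> u i = 0" "(\<Sum>i\<in>A. (u i)\<^sup>2) = 1" "(\<Sum>i\<in>A. x i * u i) = 0"
    "(\<Sum>j\<in>J. (\<Sum>i\<in>A. a j i * u i)\<^sup>2 / d j ^ 4) \<le> 4 / (3 * sqrt (real (card A))) * (\<Sum>j\<in>J. 1 / d j ^ 3)"
proof -
  define k where "k = card A"
  define E where "E = {j\<in>J. 1 / (d j)\<^sup>2 > 4 / (9 * real k)}"
  have E: "finite E" "E \<subseteq> J" using fin by (auto simp: E_def)
  have k0: "k \<ge> 3" using k by (simp add: k_def)
  have "real (card E) * (4 / (9 * real k)) \<le> (\<Sum>j\<in>E. 1 / (d j)\<^sup>2)"
    by (intro sum_bounded_below) (auto simp: E_def less_imp_le)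
  also have "\<dots> \<le> (\<Sum>j\<in>J. 1 / (d j)\<^sup>2)" using E fin by (intro sum_mono2) auto
  finally have "real (card E) * (4 / (9 * real k)) \<le> 1 / 9" using Phi by simp
  then have "4 * real (card E) \<le> real k" using k0 by (simp add: field_simps)
  then have cE: "4 * card E \<le> k" by linarith
  \<comment> \<open>\<open>None\<close> stands for orthogonality to \<open>x\<close>, and
    \<open>Some j\<close> for orthogonality to the nearly tight constraint \<open>j\<close>.\<close>
  define R where "R = insert None (Some ` E)"
  have R: "finite R" "card R = Suc (card E)" using E by (auto simp: R_def card_image)
  have cR: "card R < card A" "k \<le> 2 * (card A - card R)" using cE k0 R(2) by (auto simp: k_def[symmetric])
  define w where "w = (\<lambda>j. 1 / d j ^ 3)"
  have w0: "w j \<ge> 0" if "j \<in> J" for j using d[OF that] by (simp add: w_def)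
  obtain u where u: "\<And>i. i \<notin> A \<Longrightarrow> u i = 0" "(\<Sum>i\<in>A. (u i)\<^sup>2) = 1"
    "\<And>r. r \<in> R \<Longrightarrow> (\<Sum>i\<in>A. case_option x a r i * u i) = 0"
    "real (card A - card R) * (\<Sum>j\<in>J. w j * (\<Sum>i\<in>A. a j i * u i)\<^sup>2) \<le> (\<Sum>j\<in>J. w j * (\<Sum>i\<in>A. (a j i)\<^sup>2))"
    using low_energy_direction[OF R(1) fin(1) cR(1), of J w "case_option x a" a] w0 by blast
  define V where "V = (\<Sum>j\<in>J. w j * (\<Sum>i\<in>A. a j i * u i)\<^sup>2)"
  have V0: "V \<ge> 0" unfolding V_def by (intro sum_nonneg mult_nonneg_nonneg w0) auto
  \<comment> \<open>The trace is at most \<open>k\<close> times the total weight, since the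
    coefficients have modulus at most 1; the kernel has dimension at least \<open>k / 2\<close>,
    which leaves the factor 2.\<close>
  have "V \<le> 2 * (\<Sum>j\<in>J. w j)"
  proof -
    have "real k * V \<le> 2 * (real (card A - card R) * V)"
      using mult_right_mono[OF _ V0, of "real k" "2 * real (card A - card R)"] cR(2) by linarith
    also have "\<dots> \<le> 2 * (\<Sum>j\<in>J. w j * (\<Sum>i\<in>A. (a j i)\<^sup>2))" using u(4) by (simp add: V_def)
    also have "\<dots> \<le> 2 * (\<Sum>j\<in>J. w j * real k)"
    proof (intro mult_left_mono sum_mono w0)
      fix j assume "j \<in> J"
      then have "(\<Sum>i\<in>A. (a j i)\<^sup>2) \<le> (\<Sum>i\<in>A. 1)"
        by (intro sum_mono) (simp add: a abs_square_le_1)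
      then show "(\<Sum>i\<in>A. (a j i)\<^sup>2) \<le> real k" by (simp add: k_def)
    qed auto
    also have "\<dots> = real k * (2 * (\<Sum>j\<in>J. w j))" by (simp add: sum_distrib_right[symmetric])
    finally show ?thesis using k0 by simp
  qed
  \<comment> \<open>Terms in \<open>E\<close> vanish by orthogonality. For the others one factor
    \<open>1 / d j\<close> is bounded by the inverse of the threshold gap, and the remaining power
    is the weight \<open>w j\<close>.\<close>
  moreover have "(\<Sum>j\<in>J. (\<Sum>i\<in>A. a j i * u i)\<^sup>2 / d j ^ 4) \<le> 2 / (3 * sqrt (real k)) * V"
    unfolding V_def sum_distrib_left
  proof (intro sum_mono)
    fix j assume j: "j \<in> J"
    have dj: "d j > 0" using d j by auto
    show "(\<Sum>i\<in>A. a j i * u i)\<^sup>2 / d j ^ 4 \<le> 2 / (3 * sqrt (real k)) * (w j * (\<Sum>i\<in>A. a j i * u i)\<^sup>2)"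
    proof (cases "j \<in> E")
      case True
      then have "(\<Sum>i\<in>A. a j i * u i) = 0" using u(3)[of "Some j"] by (simp add: R_def)
      then show ?thesis by simp
    next
      case False
      then have "1 / (d j)\<^sup>2 \<le> 4 / (9 * real k)" using j by (auto simp: E_def)
      then have "(1 / d j)\<^sup>2 \<le> (2 / (3 * sqrt (real k)))\<^sup>2" by (simp add: power_divide power_mult_distrib)
      then have "1 / d j \<le> 2 / (3 * sqrt (real k))" by (rule power2_le_imp_le) simp
      then have "1 / d j * (w j * (\<Sum>i\<in>A. a j i * u i)\<^sup>2) \<le> 2 / (3 * sqrt (real k)) * (w j * (\<Sum>i\<in>A. a j i * u i)\<^sup>2)"
        using w0[OF j] by (intro mult_right_mono) auto
      then show ?thesis by (simp add: w_def power4_eq_xxxx power3_eq_cube mult_ac)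
    qed
  qed
  moreover have "2 / (3 * sqrt (real k)) * V \<le> 2 / (3 * sqrt (real k)) * (2 * (\<Sum>j\<in>J. w j))"
    using calculation(1) by (intro mult_left_mono) auto
  ultimately have "(\<Sum>j\<in>J. (\<Sum>i\<in>A. a j i * u i)\<^sup>2 / d j ^ 4) \<le> 4 / (3 * sqrt (real k)) * (\<Sum>j\<in>J. w j)" by simp
  then show ?thesis using u(1,2) u(3)[of None] by (intro that[of u]) (auto simp: R_def w_def k_def)
qed

text \<open>A move by \<open>\<epsilon>\<close> along \<open>u\<close> or \<open>-u\<close> raises
  the squared norm by exactly \<open>\<epsilon>\<^sup>2\<close>, as \<open>u\<close> is a unit
  vector orthogonal to \<open>x\<close>, and so raises the barrier by at least
  \<open>\<beta> * \<epsilon>\<^sup>2\<close>. Coordinates already at 1 or -1 stay fixed because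
  \<open>u\<close> is supported on the fractional ones.\<close>

lemma feasible_improve:
  fixes I :: "'a set" and J :: "'b set"
  assumes fin: "finite I" "finite J" and "J \<noteq> {}"
    and a: "\<And>i j. i \<in> I \<Longrightarrow> j \<in> J \<Longrightarrow> \<bar>a j i\<bar> \<le> 1"
    and x: "x \<in> feasible I J a" and k: "card {i\<in>I. \<bar>x i\<bar> < 1} \<ge> 3"
  shows "\<exists>y\<in>feasible I J a. (\<Sum>i\<in>I. (x i)\<^sup>2) < (\<Sum>i\<in>I. (y i)\<^sup>2)"
proof -
  define A where "A = {i\<in>I. \<bar>x i\<bar> < 1}"
  have A: "finite A" "A \<subseteq> I" using fin by (auto simp: A_def)
  define d where "d = barrier_gap I a x"
  have d: "d j > 0" if "j \<in> J" for j using x that by (auto simp: feasible_def d_def)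
  have Phi: "(\<Sum>j\<in>J. 1 / (d j)\<^sup>2) \<le> 1 / 9" using x by (auto simp: feasible_def d_def)
  have x1: "\<bar>x i\<bar> \<le> 1" if "i \<in> I" for i using x that by (auto simp: feasible_def)
  obtain u where u: "\<And>i. i \<notin> A \<Longrightarrow> u i = 0" "(\<Sum>i\<in>A. (u i)\<^sup>2) = 1" "(\<Sum>i\<in>A. x i * u i) = 0"
    "(\<Sum>j\<in>J. (\<Sum>i\<in>A. a j i * u i)\<^sup>2 / d j ^ 4) \<le> 4 / (3 * sqrt (real (card A))) * (\<Sum>j\<in>J. 1 / d j ^ 3)"
    by (rule fractional_direction[OF A(1) fin(2), of a d x]) (use k d Phi A(2) in \<open>auto simp: A_def intro: a\<close>)
  have ext: "(\<Sum>i\<in>A. f i * u i) = (\<Sum>i\<in>I. f i * u i)" for f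
    using A fin u(1) by (intro sum.mono_neutral_left) auto
  have uI: "(\<Sum>i\<in>I. (u i)\<^sup>2) = 1" "(\<Sum>i\<in>I. x i * u i) = 0"
    using u(2,3) ext[of u] ext[of x] by (auto simp: power2_eq_square)
  define g where "g = (\<lambda>j. \<Sum>i\<in>I. a j i * u i)"
  define s where "s = real (card I) - (\<Sum>i\<in>I. (x i)\<^sup>2)"
  have s_eq: "s = (\<Sum>i\<in>A. 1 - (x i)\<^sup>2)"
  proof -
    have "s = (\<Sum>i\<in>I. 1 - (x i)\<^sup>2)" by (simp add: s_def sum_subtractf)
    also have "\<dots> = (\<Sum>i\<in>A. 1 - (x i)\<^sup>2)"
    proof (intro sum.mono_neutral_right ballI)
      fix i assume "i \<in> I - A"
      then have "\<bar>x i\<bar> = 1" using x1[of i] by (auto simp: A_def)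
      then show "1 - (x i)\<^sup>2 = 0" by (simp add: abs_square_eq_1)
    qed (use A fin in auto)
    finally show ?thesis .
  qed
  have s0: "s > 0" unfolding s_eq
  proof (intro sum_pos A)
    show "A \<noteq> {}" using k by (auto simp: A_def[symmetric])
    show "0 < 1 - (x i)\<^sup>2" if "i \<in> A" for i using that by (simp add: A_def abs_square_less_1)
  qed
  have sk: "s \<le> real (card A)"
  proof -
    have "s \<le> (\<Sum>i\<in>A. 1)" unfolding s_eq by (intro sum_mono) auto
    then show ?thesis by simp
  qed
  define \<beta> where "\<beta> = 3 / sqrt s"
  have \<beta>: "\<beta> > 0" using s0 by (simp add: \<beta>_def)
  \<comment> \<open>This is where the constants of the barrier meet: \<open>s\<close> is at most the
    number of fractional coordinates, and 8/3 < 3.\<close>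
  have less: "2 * (\<Sum>j\<in>J. (g j)\<^sup>2 / d j ^ 4) < \<beta> * (\<Sum>j\<in>J. 1 / d j ^ 3)"
  proof -
    have S: "(\<Sum>j\<in>J. 1 / d j ^ 3) > 0" using fin \<open>J \<noteq> {}\<close> d by (intro sum_pos) auto
    have "2 * (\<Sum>j\<in>J. (g j)\<^sup>2 / d j ^ 4) \<le> 8 / (3 * sqrt (real (card A))) * (\<Sum>j\<in>J. 1 / d j ^ 3)"
      using u(4) by (simp add: ext g_def)
    also have "\<dots> < \<beta> * (\<Sum>j\<in>J. 1 / d j ^ 3)"
    proof (rule mult_strict_right_mono[OF _ S])
      have "8 / (3 * sqrt (real (card A))) \<le> 8 / (3 * sqrt s)"
        using s0 sk by (intro divide_left_mono) auto
      also have "\<dots> < \<beta>" using s0 by (simp add: \<beta>_def field_simps)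
      finally show "8 / (3 * sqrt (real (card A))) < \<beta>" .
    qed
    finally show ?thesis .
  qed
  have step: "\<forall>\<^sub>F \<epsilon> in at_right 0. (\<forall>j\<in>J. d j + \<beta> * \<epsilon>\<^sup>2 - \<epsilon> * \<bar>g j\<bar> > 0) \<and>
    (\<exists>\<sigma>\<in>{-1, 1}. (\<Sum>j\<in>J. 1 / (d j + \<beta> * \<epsilon>\<^sup>2 - \<sigma> * \<epsilon> * g j)\<^sup>2) \<le> (\<Sum>j\<in>J. 1 / (d j)\<^sup>2))"
    by (rule potential_step[OF fin(2) d \<beta> less])
  have cube: "\<forall>\<^sub>F \<epsilon> in at_right (0::real). \<forall>i\<in>A. \<bar>x i\<bar> + \<epsilon> * \<bar>u i\<bar> < 1"
  proof (intro eventually_ball_finite A(1) ballI)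
    fix i assume "i \<in> A"
    have "((\<lambda>\<epsilon>. \<bar>x i\<bar> + \<epsilon> * \<bar>u i\<bar>) \<longlongrightarrow> \<bar>x i\<bar> + 0 * \<bar>u i\<bar>) (at_right 0)" by (intro tendsto_intros)
    then show "\<forall>\<^sub>F \<epsilon> in at_right 0. \<bar>x i\<bar> + \<epsilon> * \<bar>u i\<bar> < 1"
      using \<open>i \<in> A\<close> by (intro order_tendstoD(2)) (auto simp: A_def)
  qed
  have pos: "\<forall>\<^sub>F \<epsilon> in at_right 0. \<epsilon> > (0::real)" by (simp add: eventually_at_right_less)
  have "\<forall>\<^sub>F \<epsilon> in at_right 0. \<epsilon>\<^sup>2 < s"
  proof -
    have "((\<lambda>\<epsilon>::real. \<epsilon>\<^sup>2) \<longlongrightarrow> 0\<^sup>2) (at_right 0)" by (intro tendsto_intros)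
    then show ?thesis using s0 by (intro order_tendstoD(2)) auto
  qed
  with step cube pos have "\<forall>\<^sub>F \<epsilon> in at_right 0. \<epsilon> > 0 \<and> \<epsilon>\<^sup>2 < s \<and> (\<forall>i\<in>A. \<bar>x i\<bar> + \<epsilon> * \<bar>u i\<bar> < 1) \<and>
     (\<forall>j\<in>J. d j + \<beta> * \<epsilon>\<^sup>2 - \<epsilon> * \<bar>g j\<bar> > 0) \<and>
     (\<exists>\<sigma>\<in>{-1, 1}. (\<Sum>j\<in>J. 1 / (d j + \<beta> * \<epsilon>\<^sup>2 - \<sigma> * \<epsilon> * g j)\<^sup>2) \<le> (\<Sum>j\<in>J. 1 / (d j)\<^sup>2))"
    by eventually_elim auto
  from eventually_happens'[OF trivial_limit_at_right_real this] obtain \<epsilon> \<sigma> where \<epsilon>: "\<epsilon> > 0" "\<epsilon>\<^sup>2 < s" "\<And>i. i \<in> A \<Longrightarrow> \<bar>x i\<bar> + \<epsilon> * \<bar>u i\<bar> < 1"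
     "\<And>j. j \<in> J \<Longrightarrow> d j + \<beta> * \<epsilon>\<^sup>2 - \<epsilon> * \<bar>g j\<bar> > 0" and \<sigma>: "\<sigma> \<in> {-1, 1}"
     "(\<Sum>j\<in>J. 1 / (d j + \<beta> * \<epsilon>\<^sup>2 - \<sigma> * \<epsilon> * g j)\<^sup>2) \<le> (\<Sum>j\<in>J. 1 / (d j)\<^sup>2)"
    by blast
  define y where "y = (\<lambda>i. x i + \<sigma> * \<epsilon> * u i)"
  have \<sigma>2: "\<sigma>\<^sup>2 = 1" using \<sigma> by auto
  have y2: "(\<Sum>i\<in>I. (y i)\<^sup>2) = (\<Sum>i\<in>I. (x i)\<^sup>2) + \<epsilon>\<^sup>2"
  proof -
    have "(\<Sum>i\<in>I. (y i)\<^sup>2) = (\<Sum>i\<in>I. (x i)\<^sup>2 + 2 * \<sigma> * \<epsilon> * (x i * u i) + \<epsilon>\<^sup>2 * (u i)\<^sup>2)"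
      by (simp add: y_def power2_sum power_mult_distrib \<sigma>2 algebra_simps)
    also have "\<dots> = (\<Sum>i\<in>I. (x i)\<^sup>2) + \<epsilon>\<^sup>2"
      by (simp only: sum.distrib sum_distrib_left[symmetric] uI)
    finally show ?thesis by simp
  qed
  have gap: "d j + \<beta> * \<epsilon>\<^sup>2 - \<sigma> * \<epsilon> * g j \<le> barrier_gap I a y j" for j
  proof -
    have "(\<Sum>i\<in>I. a j i * y i) = (\<Sum>i\<in>I. a j i * x i) + \<sigma> * \<epsilon> * g j"
      by (simp add: y_def g_def algebra_simps sum.distrib sum_distrib_left)
    moreover have "sqrt (s - \<epsilon>\<^sup>2) \<le> sqrt s - \<epsilon>\<^sup>2 / (2 * sqrt s)"
      using s0 \<epsilon> by (intro sqrt_diff_le) auto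
    moreover have "\<beta> * \<epsilon>\<^sup>2 = 6 * (\<epsilon>\<^sup>2 / (2 * sqrt s))" by (simp add: \<beta>_def)
    ultimately show ?thesis by (simp add: barrier_gap_def d_def y2 s_def[symmetric] diff_diff_eq[symmetric])
  qed
  have pos': "0 < d j + \<beta> * \<epsilon>\<^sup>2 - \<sigma> * \<epsilon> * g j" if "j \<in> J" for j
  proof -
    have "\<bar>\<sigma> * \<epsilon> * g j\<bar> = \<epsilon> * \<bar>g j\<bar>" using \<sigma>(1) \<epsilon>(1) by (auto simp: abs_mult)
    then have "\<sigma> * \<epsilon> * g j \<le> \<epsilon> * \<bar>g j\<bar>" by linarith
    then show ?thesis using \<epsilon>(4)[OF that] by linarith
  qed
  have "y \<in> feasible I J a" unfolding feasible_def
  proof (intro CollectI conjI ballI allI impI)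
    fix i assume i: "i \<in> I"
    show "\<bar>y i\<bar> \<le> 1"
    proof (cases "i \<in> A")
      case True
      have "\<bar>y i\<bar> \<le> \<bar>x i\<bar> + \<bar>\<sigma> * \<epsilon> * u i\<bar>" unfolding y_def by (rule abs_triangle_ineq)
      also have "\<bar>\<sigma> * \<epsilon> * u i\<bar> = \<epsilon> * \<bar>u i\<bar>" using \<sigma> \<epsilon> by (auto simp: abs_mult)
      finally show ?thesis using \<epsilon>(3)[OF True] by linarith
    next
      case False then show ?thesis using x1[OF i] u(1) by (simp add: y_def)
    qed
  next
    fix i assume "i \<notin> I"
    then show "y i = 0" using x u(1) A(2) by (auto simp: y_def feasible_def)
  next
    fix j assume "j \<in> J"
    then show "0 < barrier_gap I a y j" using gap[of j] pos'[of j] by linarith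
  next
    have "(\<Sum>j\<in>J. 1 / (barrier_gap I a y j)\<^sup>2) \<le> (\<Sum>j\<in>J. 1 / (d j + \<beta> * \<epsilon>\<^sup>2 - \<sigma> * \<epsilon> * g j)\<^sup>2)"
      using gap pos' by (intro sum_inverse_square_antimono)
    then show "(\<Sum>j\<in>J. 1 / (barrier_gap I a y j)\<^sup>2) \<le> 1 / 9" using \<sigma>(2) Phi by linarith
  qed
  moreover have "(\<Sum>i\<in>I. (x i)\<^sup>2) < (\<Sum>i\<in>I. (y i)\<^sup>2)" using y2 \<epsilon>(1) by simp
  ultimately show ?thesis by blast
qed

section \<open>Sign choice from a feasible point of maximal norm\<close>

lemma zero_feasible:
  assumes "finite I" "I \<noteq> {}" "finite J" "card J \<le> 4 * card I"
  shows "(\<lambda>_. 0) \<in> feasible I J a"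
proof -
  have n: "card I > 0" using assms by (simp add: card_gt_0_iff)
  have g: "barrier_gap I a (\<lambda>_. 0) j = 6 * sqrt (real (card I))" for j by (simp add: barrier_gap_def)
  have "real (card J) \<le> 4 * real (card I)" using assms(4) by linarith
  then show ?thesis using n by (auto simp: feasible_def g power_mult_distrib field_simps)
qed

text \<open>A feasible point of maximal norm exists by compactness and has at most two fractional
  coordinates, since otherwise \<open>feasible_improve\<close> applies. The constant is 12, the
  ceiling of the barrier, plus 2 for rounding.\<close>

lemma spencer_signs:
  fixes I :: "'a set" and J :: "'b set"
  assumes fin: "finite I" "finite J" and ne: "I \<noteq> {}" "J \<noteq> {}" and card: "card J \<le> 4 * card I"
    and a: "\<And>i j. i \<in> I \<Longrightarrow> j \<in> J \<Longrightarrow> \<bar>a j i\<bar> \<le> 1"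
  shows "\<exists>x. (\<forall>i\<in>I. x i \<in> {-1, 1::real}) \<and> (\<forall>j\<in>J. (\<Sum>i\<in>I. a j i * x i) \<le> 14 * sqrt (real (card I)))"
proof -
  have "continuous_on (feasible I J a) (\<lambda>x. \<Sum>i\<in>I. (x i)\<^sup>2)"
    by (rule continuous_on_subset[OF _ subset_UNIV])
      (intro continuous_intros continuous_on_product_coordinates)
  moreover have "feasible I J a \<noteq> {}" using zero_feasible[OF fin(1) ne(1) fin(2) card] by blast
  ultimately obtain x where x: "x \<in> feasible I J a"
    and max: "\<And>y. y \<in> feasible I J a \<Longrightarrow> (\<Sum>i\<in>I. (y i)\<^sup>2) \<le> (\<Sum>i\<in>I. (x i)\<^sup>2)"
    using continuous_attains_sup[OF compact_feasible[OF fin]] by blast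
  define A where "A = {i\<in>I. \<bar>x i\<bar> < 1}"
  have A: "A \<subseteq> I" "finite A" using fin by (auto simp: A_def)
  have "card A \<le> 2"
  proof (rule ccontr)
    assume "\<not> card A \<le> 2"
    then have "3 \<le> card {i\<in>I. \<bar>x i\<bar> < 1}" by (simp add: A_def)
    then obtain y where "y \<in> feasible I J a" "(\<Sum>i\<in>I. (x i)\<^sup>2) < (\<Sum>i\<in>I. (y i)\<^sup>2)"
      using feasible_improve[OF fin ne(2) a x] by blast
    then show False using max[of y] by linarith
  qed
  have x1: "\<bar>x i\<bar> \<le> 1" if "i \<in> I" for i using x that by (auto simp: feasible_def)
  \<comment> \<open>Rounding to the nearest sign leaves the coordinates of modulus 1 alone and moves
    each fractional one by at most 1.\<close>
  define y where "y = (\<lambda>i. if x i \<ge> 0 then 1 else -1 :: real)"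
  have "(\<Sum>i\<in>I. a j i * y i) \<le> 14 * sqrt (real (card I))" if j: "j \<in> J" for j
  proof -
    have "(\<Sum>i\<in>I. a j i * y i) = (\<Sum>i\<in>I. a j i * x i) + (\<Sum>i\<in>I. a j i * (y i - x i))"
      by (simp add: sum.distrib[symmetric] algebra_simps)
    also have "(\<Sum>i\<in>I. a j i * (y i - x i)) = (\<Sum>i\<in>A. a j i * (y i - x i))"
    proof (intro sum.mono_neutral_right ballI)
      fix i assume i: "i \<in> I - A"
      then have "\<bar>x i\<bar> = 1" using x1[of i] by (auto simp: A_def)
      then show "a j i * (y i - x i) = 0" by (auto simp: y_def abs_if split: if_splits)
    qed (use A fin in auto)
    also have "\<dots> \<le> (\<Sum>i\<in>A. 1)"
    proof (intro sum_mono)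
      fix i assume i: "i \<in> A"
      have "\<bar>y i - x i\<bar> \<le> 1" using i by (auto simp: A_def y_def)
      then have "\<bar>a j i * (y i - x i)\<bar> \<le> 1 * 1"
        unfolding abs_mult using i A j a[of i j] by (intro mult_mono) auto
      then show "a j i * (y i - x i) \<le> 1" by simp
    qed
    also have "\<dots> \<le> 2" using \<open>card A \<le> 2\<close> by simp
    finally have "(\<Sum>i\<in>I. a j i * y i) \<le> (\<Sum>i\<in>I. a j i * x i) + 2" by simp
    moreover have "(\<Sum>i\<in>I. a j i * x i) < 12 * sqrt (real (card I))"
    proof -
      have "(\<Sum>i\<in>I. (x i)\<^sup>2) \<le> (\<Sum>i\<in>I. 1)" by (intro sum_mono) (simp add: x1 abs_square_le_1)
      then have "sqrt (real (card I) - (\<Sum>i\<in>I. (x i)\<^sup>2)) \<ge> 0" by simp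
      moreover have "barrier_gap I a x j > 0" using x j by (auto simp: feasible_def)
      ultimately show ?thesis unfolding barrier_gap_def by linarith
    qed
    moreover have "1 \<le> sqrt (real (card I))" using fin ne by (simp add: Suc_leI card_gt_0_iff)
    ultimately show ?thesis by linarith
  qed
  then show ?thesis by (intro exI[of _ y]) (auto simp: y_def)
qed

subsection \<open>Norming sets for polynomials\<close>

text \<open>Distinct powers below \<open>N\<close> are orthogonal over the \<open>N\<close>-th roots
  of unity. Rotating the nodes by \<open>\<eta>\<close> only multiplies the coefficients by numbers
  of modulus 1.\<close>

lemma discrete_parseval:
  fixes f :: "complex poly"
  assumes "degree f < N" "norm \<eta> = 1"
  shows "(\<Sum>j<N. (norm (poly f (\<eta> * cis (2 * pi * real j / real N))))\<^sup>2) = real N * (\<Sum>k<N. (norm (coeff f k))\<^sup>2)"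
proof -
  define \<omega> where "\<omega> = (\<lambda>j. cis (2 * pi * real j / real N))"
  have N: "N > 0" using assms by auto
  
  have ortho: "(\<Sum>j<N. \<omega> j ^ k * cnj (\<omega> j ^ l)) = (if k = l then of_nat N else 0)" if "k < N" "l < N" for k l
  proof -
    define z where "z = cis (2 * pi * (real k - real l) / real N)"
    have z: "\<omega> j ^ k * cnj (\<omega> j ^ l) = z ^ j" for j
      using N by (simp only: \<omega>_def z_def Complex.DeMoivre cis_cnj complex_cnj_power cis_mult)
        (rule arg_cong[of _ _ cis], simp add: field_simps)
    show ?thesis
    proof (cases "k = l")
      case True then show ?thesis unfolding z by (simp add: z_def)
    next
      case False
      \<comment> \<open>\<open>z = 1\<close> would make \<open>N\<close> divide
        \<open>k - l\<close>, which is nonzero and smaller than \<open>N\<close> in modulus. Since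
        \<open>z ^ N = 1\<close>, the geometric sum then vanishes.\<close>
      have "z \<noteq> 1"
      proof
        assume "z = 1"
        then have "cos (2 * pi * (real k - real l) / real N) = 1" by (simp add: z_def complex_eq_iff)
        then obtain m :: int where "2 * pi * (real k - real l) / real N = of_int m * 2 * pi"
          by (auto simp: cos_one_2pi_int)
        then have "(2 * pi) * (real k - real l) = (2 * pi) * (of_int m * real N)" using N by (simp add: field_simps)
        then have "real_of_int (int k - int l) = of_int (m * int N)" unfolding mult_cancel_left by simp
        then have "int k - int l = m * int N" by (simp only: of_int_eq_iff)
        then have "int N dvd int k - int l" by simp
        moreover have "\<bar>int k - int l\<bar> < int N" using that by auto
        ultimately show False using False by (metis zdvd_imp_le abs_ge_zero dvd_abs_iff eq_iff_diff_eq_0 less_le_not_le linorder_not_le of_nat_eq_iff zero_less_abs_iff)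
      qed
      moreover have "z ^ N = 1"
      proof -
        have "z ^ N = cis (2 * pi * of_int (int k - int l))" using N by (simp add: z_def Complex.DeMoivre)
        also have "\<dots> = 1" by (rule cis_multiple_2pi) simp
        finally show ?thesis .
      qed
      ultimately show ?thesis unfolding z using False by (simp add: sum_gp_strict)
    qed
  qed
  define b where "b = (\<lambda>k. coeff f k * \<eta> ^ k)"
  have nb: "b k * cnj (b k) = of_real ((norm (coeff f k))\<^sup>2)" for k
    by (simp only: complex_norm_square[symmetric]) (simp add: b_def norm_mult norm_power assms)
  have ev: "poly f (\<eta> * \<omega> j) = (\<Sum>k<N. b k * \<omega> j ^ k)" for j
  proof -
    have "poly f (\<eta> * \<omega> j) = (\<Sum>k\<le>degree f. coeff f k * (\<eta> * \<omega> j) ^ k)" by (rule poly_altdef)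
    also have "\<dots> = (\<Sum>k<N. coeff f k * (\<eta> * \<omega> j) ^ k)"
      using assms by (intro sum.mono_neutral_left) (auto simp: coeff_eq_0)
    finally show ?thesis by (simp add: b_def power_mult_distrib mult_ac)
  qed
  have "complex_of_real (\<Sum>j<N. (norm (poly f (\<eta> * \<omega> j)))\<^sup>2) = (\<Sum>j<N. \<Sum>k<N. \<Sum>l<N. b k * cnj (b l) * (\<omega> j ^ k * cnj (\<omega> j ^ l)))"
    by (simp only: of_real_sum complex_norm_square ev cnj_sum complex_cnj_mult sum_product) (simp add: mult_ac)
  also have "\<dots> = (\<Sum>k<N. \<Sum>l<N. \<Sum>j<N. b k * cnj (b l) * (\<omega> j ^ k * cnj (\<omega> j ^ l)))"
    by (subst sum.swap, rule sum.cong[OF refl], rule sum.swap)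
  also have "\<dots> = (\<Sum>k<N. \<Sum>l<N. b k * cnj (b l) * (if k = l then of_nat N else 0))"
    by (intro sum.cong refl) (simp add: sum_distrib_left[symmetric] ortho del: complex_cnj_power)
  also have "\<dots> = (\<Sum>k<N. b k * cnj (b k) * of_nat N)"
    by (simp add: sum.delta' if_distrib cong: if_cong)
  also have "\<dots> = complex_of_real (real N * (\<Sum>k<N. (norm (coeff f k))\<^sup>2))"
    by (simp add: nb sum_distrib_left mult_ac)
  finally show ?thesis unfolding of_real_eq_iff \<omega>_def .
qed

text \<open>Triangle inequality, Cauchy-Schwarz over the \<open>N\<close> coefficients, then
  Parseval, whose factor \<open>N\<close> cancels the one from Cauchy-Schwarz.\<close>

lemma norm_poly_le_equispaced:
  fixes f :: "complex poly"
  assumes "degree f < N" "norm \<eta> = 1" "norm w = 1"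
  shows "(norm (poly f w))\<^sup>2 \<le> (\<Sum>j<N. (norm (poly f (\<eta> * cis (2 * pi * real j / real N))))\<^sup>2)"
proof -
  have "norm (poly f w) \<le> (\<Sum>k\<le>degree f. norm (coeff f k * w ^ k))"
    unfolding poly_altdef by (rule norm_sum)
  also have "\<dots> = (\<Sum>k<N. norm (coeff f k))"
    using assms by (intro sum.mono_neutral_cong_left) (auto simp: norm_mult norm_power coeff_eq_0)
  finally have "(norm (poly f w))\<^sup>2 \<le> (\<Sum>k<N. norm (coeff f k))\<^sup>2" by (rule power_mono) simp
  also have "\<dots> \<le> real N * (\<Sum>k<N. (norm (coeff f k))\<^sup>2)"
    using sum_squared_le_sum_of_squares[of "\<lambda>k. norm (coeff f k)" "{..<N}"] by (simp add: mult.commute)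
  finally show ?thesis using discrete_parseval[OF assms(1,2)] by simp
qed

text \<open>On the unit circle \<open>1 + z\<^sup>2 = 2 * Re z * z\<close>, so
  \<open>z ^ n * q (Re z)\<close> agrees there with a polynomial in \<open>z\<close> of degree at
  most \<open>2 * n\<close>, and the factor \<open>z ^ n\<close> has modulus 1.\<close>

lemma exists_trig_lift:
  fixes q :: "real poly"
  assumes "degree q \<le> n"
  obtains G :: "complex poly" where "degree G \<le> 2 * n"
    "\<And>z. norm z = 1 \<Longrightarrow> norm (poly G z) = \<bar>poly q (Re z)\<bar>"
proof -
  define t where "t = (\<lambda>i. smult (complex_of_real (coeff q i / 2 ^ i)) ([:1, 0, 1:] ^ i * monom 1 (n - i)))"
  define G where "G = (\<Sum>i\<le>n. t i)"
  have "degree G \<le> 2 * n" unfolding G_def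
  proof (intro degree_sum_le)
    fix i assume i: "i \<in> {..n}"
    have "degree (t i) \<le> degree ([:1, 0, 1::complex:] ^ i) + degree (monom (1::complex) (n - i))"
      unfolding t_def by (rule order_trans[OF degree_smult_le degree_mult_le])
    also have "\<dots> \<le> 2 * i + (n - i)"
      by (intro add_mono degree_monom_le order_trans[OF degree_power_le]) simp
    also have "\<dots> \<le> 2 * n" using i by simp
    finally show "degree (t i) \<le> 2 * n" .
  qed simp
  moreover have "norm (poly G z) = \<bar>poly q (Re z)\<bar>" if z: "norm z = 1" for z
  proof -
    have "z * cnj z = 1" using z by (simp add: complex_norm_square[symmetric])
    then have z2: "1 + z * z = 2 * of_real (Re z) * z"
      by (metis complex_add_cnj distrib_left mult.commute of_real_mult of_real_numeral add.commute mult.assoc)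
    have ti: "poly (t i) z = of_real (coeff q i * Re z ^ i) * z ^ n" if "i \<le> n" for i
    proof -
      have "poly (t i) z = of_real (coeff q i / 2 ^ i) * ((2 * of_real (Re z) * z) ^ i * z ^ (n - i))"
        by (simp add: t_def poly_monom z2)
      also have "\<dots> = of_real (coeff q i * Re z ^ i) * (z ^ i * z ^ (n - i))"
        by (simp add: power_mult_distrib)
      finally show ?thesis using that by (simp add: power_add[symmetric])
    qed
    have "poly q (Re z) = (\<Sum>i\<le>n. coeff q i * Re z ^ i)"
      unfolding poly_altdef using assms by (intro sum.mono_neutral_left) (auto simp: coeff_eq_0)
    then have "poly G z = of_real (poly q (Re z)) * z ^ n"
      by (simp add: G_def poly_sum ti sum_distrib_right[symmetric])
    then show ?thesis using z by (simp add: norm_mult norm_power)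
  qed
  ultimately show ?thesis by (rule that)
qed

text \<open>Writing \<open>x = Re w\<close>, the lift of \<open>q\<close> is multiplied by the kernel \<open>\<Sum>k<r. (cnj w * z) ^ k\<close>,
  which equals \<open>r\<close> at \<open>w\<close> and has only \<open>r\<close> coefficients, all of modulus 1.\<close>

lemma norming_equispaced:
  fixes q :: "real poly"
  assumes q: "degree q \<le> n" and r: "r > 0" and N: "N = 2 * n + r" and "norm \<eta> = 1"
    and M: "\<And>j. j < N \<Longrightarrow> \<bar>poly q (Re (\<eta> * cis (2 * pi * real j / real N)))\<bar> \<le> M"
    and x: "\<bar>x\<bar> \<le> 1"
  shows "real r * (poly q x)\<^sup>2 \<le> real N * M\<^sup>2"
proof -
  obtain G where G: "degree G \<le> 2 * n" "\<And>z. norm z = 1 \<Longrightarrow> norm (poly G z) = \<bar>poly q (Re z)\<bar>"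
    using exists_trig_lift[OF q] by blast
  define w where "w = cis (arccos x)"
  have w: "norm w = 1" "Re w = x" using x by (auto simp: w_def cos_arccos_abs)
  define K where "K = (\<Sum>k<r. monom (cnj w ^ k) k)"
  have cK: "coeff K k = (if k < r then cnj w ^ k else 0)" for k
    by (simp add: K_def coeff_sum)
  have dK: "degree K < r" unfolding K_def
    using r by (intro degree_sum_less) (auto intro: le_less_trans[OF degree_monom_le])
  have "cnj w * w = 1" using w by (simp add: complex_norm_square[symmetric] mult.commute)
  then have Kw: "poly K w = of_nat r"
    by (simp add: K_def poly_sum poly_monom power_mult_distrib[symmetric])
  \<comment> \<open>The choice \<open>N = 2 * n + r\<close> is made for this: the product has degree
    at most \<open>2 * n + r - 1\<close>.\<close>
  have dN: "degree (G * K) < N"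
    using degree_mult_le[of G K] G(1) dK N by linarith
  have "(real r * \<bar>poly q x\<bar>)\<^sup>2 = (norm (poly (G * K) w))\<^sup>2"
    using G(2)[of w] w by (simp add: Kw norm_mult mult.commute)
  also have "\<dots> \<le> (\<Sum>j<N. (norm (poly (G * K) (\<eta> * cis (2 * pi * real j / real N))))\<^sup>2)"
    by (intro norm_poly_le_equispaced dN w assms)
  also have "\<dots> \<le> (\<Sum>j<N. M\<^sup>2 * (norm (poly K (\<eta> * cis (2 * pi * real j / real N))))\<^sup>2)"
  proof (intro sum_mono)
    fix j assume "j \<in> {..<N}"
    then have "norm (poly G (\<eta> * cis (2 * pi * real j / real N))) \<le> M"
      using M[of j] by (subst G(2)) (auto simp: norm_mult assms(4))
    then have "(norm (poly G (\<eta> * cis (2 * pi * real j / real N))))\<^sup>2 \<le> M\<^sup>2" by (intro power_mono) auto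
    then show "(norm (poly (G * K) (\<eta> * cis (2 * pi * real j / real N))))\<^sup>2 \<le> M\<^sup>2 * (norm (poly K (\<eta> * cis (2 * pi * real j / real N))))\<^sup>2"
      by (simp add: norm_mult power_mult_distrib mult_right_mono)
  qed
  \<comment> \<open>Parseval a second time, now for \<open>K\<close> alone, whose coefficients have
    squared moduli summing to \<open>r\<close>.\<close>
  also have "\<dots> = M\<^sup>2 * (real N * (\<Sum>k<N. (norm (coeff K k))\<^sup>2))"
    using dK N by (subst discrete_parseval[symmetric, where \<eta> = \<eta>]) (auto simp: sum_distrib_left assms(4))
  also have "(\<Sum>k<N. (norm (coeff K k))\<^sup>2) = (\<Sum>k<r. 1)"
    using N w by (intro sum.mono_neutral_cong_right) (auto simp: cK norm_power)
  finally have "real r * (real r * (poly q x)\<^sup>2) \<le> real r * (real N * M\<^sup>2)"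
    by (simp add: power2_eq_square mult_ac)
  then show ?thesis using r by simp
qed

text \<open>The case \<open>r = 2 * n\<close>, \<open>N = 4 * n\<close>, where
  \<open>N / r = 2\<close> yields the factor \<open>sqrt 2\<close>. Rotation by half a step puts the
  \<open>4 * n\<close> points at odd multiples of \<open>pi / (4 * n)\<close>; they are symmetric
  about the real axis and project to the \<open>2 * n\<close> Chebyshev nodes.\<close>

lemma norming_chebyshev_nodes:
  fixes q :: "real poly"
  assumes q: "degree q \<le> n" and n: "n \<ge> 1"
    and M: "\<And>j. j < 2 * n \<Longrightarrow> \<bar>poly q (cos (real (2 * j + 1) * pi / real (4 * n)))\<bar> \<le> M"
    and x: "\<bar>x\<bar> \<le> 1"
  shows "\<bar>poly q x\<bar> \<le> sqrt 2 * M"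
proof -
  have M0: "M \<ge> 0" using M[of 0] n by (auto intro: order_trans[OF abs_ge_zero])
  have "real (2 * n) * (poly q x)\<^sup>2 \<le> real (4 * n) * M\<^sup>2"
  proof (rule norming_equispaced[OF q, where \<eta> = "cis (pi / real (4 * n))"])
    fix j assume j: "j < 4 * n"
    have e: "Re (cis (pi / real (4 * n)) * cis (2 * pi * real j / real (4 * n))) = cos (real (2 * j + 1) * pi / real (4 * n))"
      using n by (simp add: cis_mult) (rule arg_cong[of _ _ cos], simp add: field_simps)
    show "\<bar>poly q (Re (cis (pi / real (4 * n)) * cis (2 * pi * real j / real (4 * n))))\<bar> \<le> M"
    proof (cases "j < 2 * n")
      case True then show ?thesis unfolding e by (rule M)
    next
      case False
      \<comment> \<open>Index of the complex conjugate point, which lies in the upper half circle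
        and has the same real part.\<close>
      define i where "i = 4 * n - 1 - j"
      have i: "i < 2 * n" using False j by (auto simp: i_def)
      have ij: "real (2 * j + 1) = 8 * real n - real (2 * i + 1)" using j by (simp add: i_def of_nat_diff)
      have "real (2 * j + 1) * pi / real (4 * n) = 2 * pi - real (2 * i + 1) * pi / real (4 * n)"
        unfolding ij using n by (simp add: field_simps)
      then have "cos (real (2 * j + 1) * pi / real (4 * n)) = cos (real (2 * i + 1) * pi / real (4 * n))"
        by (simp only: cos_2pi_minus)
      then show ?thesis unfolding e using M[OF i] by simp
    qed
  qed (use n x in auto)
  then have "(poly q x)\<^sup>2 \<le> (sqrt 2 * M)\<^sup>2" using n by (simp add: power_mult_distrib)
  then show ?thesis using M0 by (simp add: power2_le_iff_abs_le)
qed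

section \<open>Balancing polynomials in the Chebyshev norm\<close>

lemma abs_poly_le_chebyshev_norm: "\<bar>x\<bar> \<le> 1 \<Longrightarrow> \<bar>poly p x\<bar> \<le> chebyshev_norm p"
  unfolding chebyshev_norm_def by (rule cSUP_upper[OF _ bdd_above_abs_poly]) (auto simp: abs_le_iff)

theorem theorem1:
  fixes n :: nat and p :: "nat \<Rightarrow> real poly"
  assumes "n \<ge> 1"
    and "\<And>i. i \<in> {1..n} \<Longrightarrow> degree (p i) \<le> n"
    and "\<And>i. i \<in> {1..n} \<Longrightarrow> chebyshev_norm (p i) \<le> 1"
  shows "\<exists>x :: nat \<Rightarrow> real. (\<forall>i\<in>{1..n}. x i \<in> {-1, 1}) \<and>
           chebyshev_norm (\<Sum>i=1..n. smult (x i) (p i)) < 30 * sqrt (real n)"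
proof -
  define t where "t = (\<lambda>j::nat. cos (real (2 * j + 1) * pi / real (4 * n)))"
  \<comment> \<open>Each node occurs with both signs, so that one-sided bounds control absolute
    values; this gives exactly the \<open>4 * n\<close> constraints that
    \<open>spencer_signs\<close> allows.\<close>
  define J where "J = {..<2 * n} \<times> {-1, 1::real}"
  define a where "a = (\<lambda>(j, \<sigma>::real) i. \<sigma> * poly (p i) (t j))"
  have pt: "\<bar>poly (p i) (t j)\<bar> \<le> 1" if "i \<in> {1..n}" for i j
    by (rule order_trans[OF abs_poly_le_chebyshev_norm assms(3)[OF that]]) (simp add: t_def)
  have "\<exists>x. (\<forall>i\<in>{1..n}. x i \<in> {-1, 1::real}) \<and> (\<forall>j\<in>J. (\<Sum>i=1..n. a j i * x i) \<le> 14 * sqrt (card {1..n}))"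
    using assms(1) pt by (intro spencer_signs) (auto simp: J_def a_def abs_mult lessThan_empty_iff)
  then have "\<exists>x. (\<forall>i\<in>{1..n}. x i \<in> {-1, 1::real}) \<and> (\<forall>j\<in>J. (\<Sum>i=1..n. a j i * x i) \<le> 14 * sqrt n)"
    by simp
  then obtain x where x: "\<And>i. i \<in> {1..n} \<Longrightarrow> x i \<in> {-1, 1::real}"
    and bound: "\<And>j. j \<in> J \<Longrightarrow> (\<Sum>i=1..n. a j i * x i) \<le> 14 * sqrt n" by blast
  define q where "q = (\<Sum>i=1..n. smult (x i) (p i))"
  have "degree q \<le> n"
    unfolding q_def by (intro degree_sum_le order_trans[OF degree_smult_le] assms) auto
  moreover have "\<bar>poly q (cos (real (2 * j + 1) * pi / real (4 * n)))\<bar> \<le> 14 * sqrt n" if "j < 2 * n" for j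
  proof -
    have "(\<Sum>i=1..n. a (j, \<sigma>) i * x i) = \<sigma> * poly q (t j)" for \<sigma>
      by (simp add: a_def q_def poly_sum sum_distrib_left mult_ac)
    then have "\<sigma> * poly q (t j) \<le> 14 * sqrt n" if "\<sigma> \<in> {-1, 1}" for \<sigma>
      using bound[of "(j, \<sigma>)"] that \<open>j < 2 * n\<close> by (simp add: J_def)
    from this[of 1] this[of "-1"] show ?thesis by (simp add: t_def abs_le_iff)
  qed
  ultimately have q: "\<bar>poly q z\<bar> \<le> sqrt 2 * (14 * sqrt n)" if "\<bar>z\<bar> \<le> 1" for z
    using norming_chebyshev_nodes[OF _ assms(1)] that by blast
  have "chebyshev_norm q \<le> sqrt 2 * (14 * sqrt n)"
    unfolding chebyshev_norm_def by (rule cSUP_least) (simp, rule q, simp add: abs_le_iff)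
  also have "\<dots> < 30 * sqrt n"
  proof -
    \<comment> \<open>15/7 is 30/14, the ratio of the target constant to the bound at the
      nodes.\<close>
    have "sqrt 2 < 15 / 7" by (rule real_less_lsqrt) (auto simp: power2_eq_square)
    then show ?thesis using assms(1) by simp
  qed
  finally show ?thesis using x unfolding q_def by blast
qed

end
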